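(* Let $E:\mathbb{R}^n\to\mathbb{R}^n$ be one-to-one and onto, let $\eta:\mathbb{R}^n\times\mathbb{R}^n\to\mathbb{R}^n$, and consider the multiobjective problem (VP) of minimizing $f=(f_1,\dots,f_p)$ subject to $g_k(x)\leq 0$ ($k\in K$) and $h_j(x)=0$ ($j\in J$), with all functions $\mathbb{R}^n\to\mathbb{R}$ and $E$-differentiable on $\mathbb{R}^n$, with feasible set $\Omega$, and with $\Omega_E=\{x\in\mathbb{R}^n: E(x)\in\Omega\}$. Let $(E(\overline{y}),\overline{\tau},\overline{\rho},\overline{\xi})\in\Omega\times\mathbb{R}^p\times\mathbb{R}^m\times\mathbb{R}^q$ be an $E$-Karush-Kuhn-Tucker point of (VP). Let $K(E(\overline{y}))=\{k\in K: g_k(E(\overline{y}))=0\}$, $J^+(E(\overline{y}))=\{j\in J:\overline{\xi}_j>0\}$ and $J^-(E(\overline{y}))=\{j\in J:\overline{\xi}_j<0\}$. Assume that, with respect to the map $\eta$: (a) each $f_i$, $i\in I$, is exponentially pseudo-$E$-invex at $\overline{y}$ on $\Omega_E$; (b) each $g_k$, $k\in K(E(\overline{y}))$, is exponentially quasi-$E$-invex at $\overline{y}$ on $\Omega_E$; (c) each $h_j$, $j\in J^+(E(\overline{y}))$, is exponentially quasi-$E$-invex at $\overline{y}$ on $\Omega_E$; (d) each $-h_j$, $j\in J^-(E(\overline{y}))$, is exponentially quasi-$E$-invex at $\overline{y}$ on $\Omega_E$. Then $E(\overline{y})$ is a weak $E$-Pareto solution of (VP).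
   Context: Index sets: $I=\{1,\dots,p\}$, $K=\{1,\dots,m\}$, $J=\{1,\dots,q\}$. The feasible set is $\Omega=\{x\in\mathbb{R}^n: g_k(x)\leq 0\ (k\in K),\ h_j(x)=0\ (j\in J)\}$. A function $\phi:\mathbb{R}^n\to\mathbb{R}$ is $E$-differentiable at $x_0$ if $\phi\circ E$ is differentiable at $x_0$ in the usual sense. Gradients are row vectors, so the product with a vector of $\mathbb{R}^n$ is the inner product. $(E(\overline{y}),\overline{\tau},\overline{\rho},\overline{\xi})\in\Omega\times\mathbb{R}^p\times\mathbb{R}^m\times\mathbb{R}^q$ is an $E$-Karush-Kuhn-Tucker point of (VP) if $$\sum_{i=1}^p\overline{\tau}_i\nabla(f_i\circ E)(\overline{y})+\sum_{k=1}^m\overline{\rho}_k\nabla(g_k\circ E)(\overline{y})+\sum_{j=1}^q\overline{\xi}_j\nabla(h_j\circ E)(\overline{y})=0,$$ $\overline{\rho}_k\,g_k(E(\overline{y}))=0$ for all $k\in K$, $\overline{\tau}_i\geq 0$ for all $i\in I$ with $\overline{\tau}\neq 0$, and $\overline{\rho}_k\geq0$ for all $k\in K$. Let $\phi$ be $E$-differentiable. With respect to $\eta$, $\phi$ is exponentially pseudo-$E$-invex at $\overline{y}$ on $\Omega_E$ if for all $x\in\Omega_E$, $$e^{\phi(E(x))}<e^{\phi(E(\overline{y}))}\ \Longrightarrow\ \nabla(\phi\circ E)(\overline{y})\,e^{\phi(E(\overline{y}))}\,\eta(E(x),E(\overline{y}))<0,$$ and exponentially quasi-$E$-invex at $\overline{y}$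 on $\Omega_E$ if for all $x\in\Omega_E$, $$e^{\phi(E(x))}\leq e^{\phi(E(\overline{y}))}\ \Longrightarrow\ \nabla(\phi\circ E)(\overline{y})\,e^{\phi(E(\overline{y}))}\,\eta(E(x),E(\overline{y}))\leq0.$$ A point $E(\overline{y})\in\Omega$ is a weak $E$-Pareto solution of (VP) if there is no $E(x)\in\Omega$ with $f_i(E(x))<f_i(E(\overline{y}))$ for all $i\in I$. *)

theory Defs
  imports "HOL-Analysis.Analysis"
begin

text \<open>
  The vector-valued data \<open>f\<close>, \<open>g\<close>, \<open>h\<close> and the multiplier vectors \<open>\<tau>\<close>, \<open>\<rho>\<close>, \<open>\<xi>\<close> are families
  indexed by \<^typ>\<open>nat\<close>, of which only the indices in \<open>{1..p}\<close>, \<open>{1..m}\<close> and \<open>{1..q}\<close>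
  respectively are relevant. In particular \<open>m\<close> and \<open>q\<close> may be \<open>0\<close>.
\<close>

text \<open>Meaningful only where \<open>\<phi>\<close> is differentiable; there \<open>GDERIV\<close> determines a unique vector.\<close>

definition gradient :: "(real ^ 'n \<Rightarrow> real) \<Rightarrow> real ^ 'n \<Rightarrow> real ^ 'n" where
  "gradient \<phi> x = (THE d. GDERIV \<phi> x :> d)"

definition E_differentiable_at ::
    "(real ^ 'n \<Rightarrow> real ^ 'n) \<Rightarrow> (real ^ 'n \<Rightarrow> real) \<Rightarrow> real ^ 'n \<Rightarrow> bool" where
  "E_differentiable_at E \<phi> x \<longleftrightarrow> (\<phi> \<circ> E) differentiable (at x)"

definition feasible_set ::
    "nat \<Rightarrow> nat \<Rightarrow> (nat \<Rightarrow> real ^ 'n \<Rightarrow> real) \<Rightarrow> (nat \<Rightarrow> real ^ 'n \<Rightarrow> real) \<Rightarrow> (real ^ 'n) set" where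
  "feasible_set m q g h = {x. (\<forall>k\<in>{1..m}. g k x \<le> 0) \<and> (\<forall>j\<in>{1..q}. h j x = 0)}"

definition E_feasible_set ::
    "(real ^ 'n \<Rightarrow> real ^ 'n) \<Rightarrow> nat \<Rightarrow> nat \<Rightarrow> (nat \<Rightarrow> real ^ 'n \<Rightarrow> real) \<Rightarrow>
      (nat \<Rightarrow> real ^ 'n \<Rightarrow> real) \<Rightarrow> (real ^ 'n) set" where
  "E_feasible_set E m q g h = {x. E x \<in> feasible_set m q g h}"

text \<open>
  The point \<open>E y\<close> is represented by \<open>y\<close>, as the gradients are taken at \<open>y\<close>.
\<close>

definition E_KKT_point ::
    "(real ^ 'n \<Rightarrow> real ^ 'n) \<Rightarrow> nat \<Rightarrow> nat \<Rightarrow> nat \<Rightarrow>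
      (nat \<Rightarrow> real ^ 'n \<Rightarrow> real) \<Rightarrow> (nat \<Rightarrow> real ^ 'n \<Rightarrow> real) \<Rightarrow> (nat \<Rightarrow> real ^ 'n \<Rightarrow> real) \<Rightarrow>
      real ^ 'n \<Rightarrow> (nat \<Rightarrow> real) \<Rightarrow> (nat \<Rightarrow> real) \<Rightarrow> (nat \<Rightarrow> real) \<Rightarrow> bool" where
  "E_KKT_point E p m q f g h y \<tau> \<rho> \<xi> \<longleftrightarrow>
     E y \<in> feasible_set m q g h \<and>
     (\<Sum>i=1..p. \<tau> i *\<^sub>R gradient (f i \<circ> E) y)
       + (\<Sum>k=1..m. \<rho> k *\<^sub>R gradient (g k \<circ> E) y)
       + (\<Sum>j=1..q. \<xi> j *\<^sub>R gradient (h j \<circ> E) y) = 0 \<and>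
     (\<forall>k\<in>{1..m}. \<rho> k * g k (E y) = 0) \<and>
     (\<forall>i\<in>{1..p}. \<tau> i \<ge> 0) \<and> (\<exists>i\<in>{1..p}. \<tau> i \<noteq> 0) \<and>
     (\<forall>k\<in>{1..m}. \<rho> k \<ge> 0)"

text \<open>
  The two invexity notions are meant for \<open>\<phi>\<close> such that \<open>\<phi> \<circ> E\<close> is differentiable at \<open>y\<close>;
  \<open>S\<close> plays the role of \<open>\<Omega>\<^sub>E\<close>.
\<close>

definition exp_pseudo_E_invex_at ::
    "(real ^ 'n \<Rightarrow> real ^ 'n) \<Rightarrow> ((real ^ 'n) \<times> (real ^ 'n) \<Rightarrow> real ^ 'n) \<Rightarrow> (real ^ 'n) set \<Rightarrow>
      (real ^ 'n \<Rightarrow> real) \<Rightarrow> real ^ 'n \<Rightarrow> bool" where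
  "exp_pseudo_E_invex_at E \<eta> S \<phi> y \<longleftrightarrow>
     (\<forall>x\<in>S. exp (\<phi> (E x)) < exp (\<phi> (E y)) \<longrightarrow>
        (exp (\<phi> (E y)) *\<^sub>R gradient (\<phi> \<circ> E) y) \<bullet> \<eta> (E x, E y) < 0)"

definition exp_quasi_E_invex_at ::
    "(real ^ 'n \<Rightarrow> real ^ 'n) \<Rightarrow> ((real ^ 'n) \<times> (real ^ 'n) \<Rightarrow> real ^ 'n) \<Rightarrow> (real ^ 'n) set \<Rightarrow>
      (real ^ 'n \<Rightarrow> real) \<Rightarrow> real ^ 'n \<Rightarrow> bool" where
  "exp_quasi_E_invex_at E \<eta> S \<phi> y \<longleftrightarrow>
     (\<forall>x\<in>S. exp (\<phi> (E x)) \<le> exp (\<phi> (E y)) \<longrightarrow>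
        (exp (\<phi> (E y)) *\<^sub>R gradient (\<phi> \<circ> E) y) \<bullet> \<eta> (E x, E y) \<le> 0)"

definition weak_E_Pareto ::
    "(real ^ 'n \<Rightarrow> real ^ 'n) \<Rightarrow> nat \<Rightarrow> nat \<Rightarrow> nat \<Rightarrow>
      (nat \<Rightarrow> real ^ 'n \<Rightarrow> real) \<Rightarrow> (nat \<Rightarrow> real ^ 'n \<Rightarrow> real) \<Rightarrow> (nat \<Rightarrow> real ^ 'n \<Rightarrow> real) \<Rightarrow>
      real ^ 'n \<Rightarrow> bool" where
  "weak_E_Pareto E p m q f g h y \<longleftrightarrow>
     E y \<in> feasible_set m q g h \<and>
     \<not> (\<exists>x. E x \<in> feasible_set m q g h \<and> (\<forall>i\<in>{1..p}. f i (E x) < f i (E y)))"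

end

theory Submission
  imports Defs
begin

text \<open>
  If \<open>E x\<close> were feasible and strictly better in every objective, then pairing the stationarity
  equation with \<open>\<eta> (E x, E y)\<close> would give \<open>0 < 0\<close>: pseudo-invexity makes the objective part
  negative because \<open>\<tau>\<close> is nonnegative and nonzero, while quasi-invexity makes the constraint parts
  nonpositive, inactive constraints having zero multiplier by complementary slackness.
\<close>

text \<open>The inner product determines its representing vector, so uniqueness of the derivative
  passes to the gradient. This justifies the definite description in
  \<open>gradient\<close>.\<close>

lemma GDERIV_unique:
  fixes \<phi> :: "'a :: euclidean_space \<Rightarrow> real"
  assumes "GDERIV \<phi> x :> d" and "GDERIV \<phi> x :> d'"
  shows "d = d'"
  using has_derivative_unique[OF assms[unfolded gderiv_def]]
  by (metis inner_commute vector_eq_rdot)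

lemma gradient_eqI:
  assumes "GDERIV \<phi> x :> d"
  shows "gradient \<phi> x = d"
  unfolding gradient_def using assms GDERIV_unique by blast

text \<open>Riesz representation: a linear functional \<open>D\<close> is the inner product with
  \<open>adjoint D 1\<close>, so differentiability alone supplies a vector for
  \<open>gradient\<close> to pick out.\<close>

lemma GDERIV_gradient:
  fixes \<phi> :: "real ^ 'n \<Rightarrow> real"
  assumes "\<phi> differentiable (at x)"
  shows "GDERIV \<phi> x :> gradient \<phi> x"
proof -
  obtain D where D: "(\<phi> has_derivative D) (at x)"
    using assms unfolding differentiable_def by blast
  then have "linear D"
    by (rule has_derivative_linear)
  then have "D = (\<lambda>v. v \<bullet> adjoint D 1)"
    using adjoint_works[of D _ 1] by simp
  with D have "GDERIV \<phi> x :> adjoint D 1"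
    unfolding gderiv_def by simp
  then show ?thesis
    using gradient_eqI by metis
qed

text \<open>Translates the assumption on the negated equality constraints into one on the gradients
  that occur in the stationarity equation.\<close>

lemma gradient_minus:
  fixes \<phi> :: "real ^ 'n \<Rightarrow> real"
  assumes "\<phi> differentiable (at x)"
  shows "gradient (\<lambda>x. - \<phi> x) x = - gradient \<phi> x"
  by (rule gradient_eqI) (rule GDERIV_minus[OF GDERIV_gradient[OF assms]])

text \<open>The exponentials drop out: \<open>exp\<close> is strictly increasing, so the premises
  compare plain values, and the factor \<open>exp (\<phi> (E y))\<close> is positive, so it leaves
  the sign of the inner product unchanged.\<close>

lemma exp_pseudo_E_invex_atD:
  assumes "exp_pseudo_E_invex_at E \<eta> S \<phi> y" and "x \<in> S" and "\<phi> (E x) < \<phi> (E y)"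
  shows "gradient (\<phi> \<circ> E) y \<bullet> \<eta> (E x, E y) < 0"
  using assms by (auto simp: exp_pseudo_E_invex_at_def mult_less_0_iff)

lemma exp_quasi_E_invex_atD:
  assumes "exp_quasi_E_invex_at E \<eta> S \<phi> y" and "x \<in> S" and "\<phi> (E x) \<le> \<phi> (E y)"
  shows "gradient (\<phi> \<circ> E) y \<bullet> \<eta> (E x, E y) \<le> 0"
  using assms by (auto simp: exp_quasi_E_invex_at_def mult_le_0_iff)

theorem theorem30:
  fixes E :: "real ^ 'n \<Rightarrow> real ^ 'n"
    and \<eta> :: "(real ^ 'n) \<times> (real ^ 'n) \<Rightarrow> real ^ 'n"
    and p m q :: nat
    and f g h :: "nat \<Rightarrow> real ^ 'n \<Rightarrow> real"
    and y :: "real ^ 'n"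
    and \<tau> \<rho> \<xi> :: "nat \<Rightarrow> real"
  assumes "bij E"
    and "\<forall>i\<in>{1..p}. \<forall>x. E_differentiable_at E (f i) x"
    and "\<forall>k\<in>{1..m}. \<forall>x. E_differentiable_at E (g k) x"
    and "\<forall>j\<in>{1..q}. \<forall>x. E_differentiable_at E (h j) x"
    and "E_KKT_point E p m q f g h y \<tau> \<rho> \<xi>"
    and "\<forall>i\<in>{1..p}. exp_pseudo_E_invex_at E \<eta> (E_feasible_set E m q g h) (f i) y"
    and "\<forall>k\<in>{k\<in>{1..m}. g k (E y) = 0}.
           exp_quasi_E_invex_at E \<eta> (E_feasible_set E m q g h) (g k) y"
    and "\<forall>j\<in>{j\<in>{1..q}. \<xi> j > 0}.
           exp_quasi_E_invex_at E \<eta> (E_feasible_set E m q g h) (h j) y"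
    and "\<forall>j\<in>{j\<in>{1..q}. \<xi> j < 0}.
           exp_quasi_E_invex_at E \<eta> (E_feasible_set E m q g h) (\<lambda>x. - h j x) y"
  shows "weak_E_Pareto E p m q f g h y"
proof -
  have y: "E y \<in> feasible_set m q g h"
    and stationary: "(\<Sum>i=1..p. \<tau> i *\<^sub>R gradient (f i \<circ> E) y)
       + (\<Sum>k=1..m. \<rho> k *\<^sub>R gradient (g k \<circ> E) y)
       + (\<Sum>j=1..q. \<xi> j *\<^sub>R gradient (h j \<circ> E) y) = 0"
    and slack: "\<forall>k\<in>{1..m}. \<rho> k * g k (E y) = 0"
    and \<tau>: "\<forall>i\<in>{1..p}. \<tau> i \<ge> 0" "\<exists>i\<in>{1..p}. \<tau> i \<noteq> 0"
    and \<rho>: "\<forall>k\<in>{1..m}. \<rho> k \<ge> 0"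
    using assms(5) by (auto simp: E_KKT_point_def)
  have False if x: "E x \<in> feasible_set m q g h"
    and less: "\<forall>i\<in>{1..p}. f i (E x) < f i (E y)" for x
  proof -
    define v where "v = \<eta> (E x, E y)"
    have xS: "x \<in> E_feasible_set E m q g h"
      using x by (simp add: E_feasible_set_def)
    have f_neg: "gradient (f i \<circ> E) y \<bullet> v < 0" if "i \<in> {1..p}" for i
      unfolding v_def using exp_pseudo_E_invex_atD assms(6) xS less that by blast
    have f_sum: "(\<Sum>i=1..p. \<tau> i * (gradient (f i \<circ> E) y \<bullet> v)) < 0"
    proof -
      obtain i where i: "i \<in> {1..p}" "\<tau> i > 0"
        using \<tau> by force
      \<comment> \<open>Other multipliers may vanish, so the terms are only nonpositive in general;
        the single index \<open>i\<close> with positive multiplier makes the sum strict.\<close>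
      have "(\<Sum>i=1..p. \<tau> i * (gradient (f i \<circ> E) y \<bullet> v)) < (\<Sum>i=1..p. 0)"
      proof (rule sum_strict_mono_ex1)
        show "\<forall>i\<in>{1..p}. \<tau> i * (gradient (f i \<circ> E) y \<bullet> v) \<le> 0"
          using \<tau>(1) f_neg by (simp add: mult_nonneg_nonpos order_less_imp_le)
        show "\<exists>i\<in>{1..p}. \<tau> i * (gradient (f i \<circ> E) y \<bullet> v) < 0"
          using i f_neg mult_pos_neg by blast
      qed simp
      then show ?thesis
        by simp
    qed
    have g_sum: "(\<Sum>k=1..m. \<rho> k * (gradient (g k \<circ> E) y \<bullet> v)) \<le> 0"
    proof (rule sum_nonpos)
      fix k assume k: "k \<in> {1..m}"
      show "\<rho> k * (gradient (g k \<circ> E) y \<bullet> v) \<le> 0"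
      proof (cases "g k (E y) = 0")
        case True
        \<comment> \<open>Since \<open>g k (E y)\<close> is 0 here, feasibility of
          \<open>E x\<close> is exactly the premise of quasi-invexity.\<close>
        moreover have "g k (E x) \<le> 0"
          using x k by (simp add: feasible_set_def)
        ultimately have "gradient (g k \<circ> E) y \<bullet> v \<le> 0"
          unfolding v_def using exp_quasi_E_invex_atD[OF _ xS] assms(7) k by simp
        then show ?thesis
          using \<rho> k by (simp add: mult_nonneg_nonpos)
      next
        case False
        then show ?thesis
          using slack k by (metis mult_eq_0_iff mult_zero_left order_refl)
      qed
    qed
    have h_sum: "(\<Sum>j=1..q. \<xi> j * (gradient (h j \<circ> E) y \<bullet> v)) \<le> 0"
    proof (rule sum_nonpos)
      fix j assume j: "j \<in> {1..q}"
      \<comment> \<open>Both values are 0 by feasibility. Equality triggers quasi-invexity for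
        \<open>h j\<close> and for its negation alike, whichever the sign of \<open>\<xi> j\<close>
        calls for.\<close>
      have h_eq: "h j (E x) = h j (E y)"
        using x y j by (simp add: feasible_set_def)
      consider "\<xi> j = 0" | "\<xi> j > 0" | "\<xi> j < 0"
        by linarith
      then show "\<xi> j * (gradient (h j \<circ> E) y \<bullet> v) \<le> 0"
      proof cases
        case 1
        then show ?thesis
          by simp
      next
        case 2
        then have "gradient (h j \<circ> E) y \<bullet> v \<le> 0"
          unfolding v_def using exp_quasi_E_invex_atD[OF _ xS] assms(8) j h_eq by simp
        then show ?thesis
          using 2 by (simp add: mult_nonneg_nonpos)
      next
        case 3
        then have "gradient ((\<lambda>x. - h j x) \<circ> E) y \<bullet> v \<le> 0"
          unfolding v_def using exp_quasi_E_invex_atD[OF _ xS] assms(9) j h_eq by simp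
        \<comment> \<open>The sign flip makes the inner product of the gradient of
          \<open>h j \<circ> E\<close> with \<open>v\<close> nonnegative, which a negative
          \<open>\<xi> j\<close> turns into a nonpositive term.\<close>
        moreover have "gradient ((\<lambda>x. - h j x) \<circ> E) y = - gradient (h j \<circ> E) y"
          using gradient_minus[of "h j \<circ> E" y] assms(4) j
          by (simp add: E_differentiable_at_def o_def)
        ultimately show ?thesis
          using 3 by (simp add: mult_nonpos_nonneg)
      qed
    qed
    have "(\<Sum>i=1..p. \<tau> i * (gradient (f i \<circ> E) y \<bullet> v))
       + (\<Sum>k=1..m. \<rho> k * (gradient (g k \<circ> E) y \<bullet> v))
       + (\<Sum>j=1..q. \<xi> j * (gradient (h j \<circ> E) y \<bullet> v)) = 0"
      using arg_cong[OF stationary, of "\<lambda>u. u \<bullet> v"]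
      by (simp add: inner_add_left inner_sum_left)
    with f_sum g_sum h_sum show False
      by linarith
  qed
  with y show ?thesis
    unfolding weak_E_Pareto_def by blast
qed

end
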